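(* Let $G$ be a finite simple undirected graph with no antitriangle that has exactly one coloring of size $\chi(G)$. Then $s(G) \geq \chi(G)$; in particular, $s(G) \geq |V(G)|/2$.
   Context: An anticlique of $G$ is a set of pairwise nonadjacent vertices; an antitriangle is an anticlique of size $3$. A coloring of $G$ is a partition of $V(G)$ into (nonempty) anticliques; its size is the number of classes; $\chi(G)$ is the smallest size of a coloring of $G$. A subset of $V(G)$ is connected if it induces a connected subgraph; two subsets of $V(G)$ are adjacent if some edge of $G$ has one end in each. A clique minor of $G$ is a set of pairwise disjoint, pairwise adjacent, connected, nonempty subsets of $V(G)$; it is shallow if all its members have size $1$ or $2$. $s(G)$ denotes the largest $k$ such that $G$ has a shallow clique minor of size $k$. *)

theory Defs
  imports "Graph_Theory.Graph_Theory" "HOL-Library.Disjoint_Sets"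
begin

text \<open>
  A finite simple undirected graph is a \<open>G\<close> satisfying the locale predicate \<open>graph\<close>, i.e. a finite,
  loop-free symmetric digraph without multiple arcs; an edge \<open>uv\<close> is the pair of its two
  orientations, and \<open>u\<close> is adjacent to \<open>v\<close> iff \<open>u \<rightarrow>\<^bsub>G\<^esub> v\<close>. The graph without vertices is allowed.
\<close>

definition anticlique :: "('a,'b) pre_digraph \<Rightarrow> 'a set \<Rightarrow> bool" where
  "anticlique G S \<longleftrightarrow> S \<subseteq> verts G \<and> pairwise (\<lambda>u v. \<not> u \<rightarrow>\<^bsub>G\<^esub> v) S"

definition antitriangle :: "('a,'b) pre_digraph \<Rightarrow> 'a set \<Rightarrow> bool" where
  "antitriangle G S \<longleftrightarrow> anticlique G S \<and> card S = 3"

text \<open>Colorings are unlabelled: a coloring is the partition into color classes.\<close>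

definition coloring :: "('a,'b) pre_digraph \<Rightarrow> 'a set set \<Rightarrow> bool" where
  "coloring G P \<longleftrightarrow> partition_on (verts G) P \<and> (\<forall>S\<in>P. anticlique G S)"

definition chromatic_number :: "('a,'b) pre_digraph \<Rightarrow> nat" where
  "chromatic_number G = (LEAST k. \<exists>P. coloring G P \<and> card P = k)"

definition connected_set :: "('a,'b) pre_digraph \<Rightarrow> 'a set \<Rightarrow> bool" where
  "connected_set G S \<longleftrightarrow> S \<subseteq> verts G \<and> connected (G \<restriction> S)"

definition adjacent_sets :: "('a,'b) pre_digraph \<Rightarrow> 'a set \<Rightarrow> 'a set \<Rightarrow> bool" where
  "adjacent_sets G S T \<longleftrightarrow> (\<exists>u\<in>S. \<exists>v\<in>T. u \<rightarrow>\<^bsub>G\<^esub> v)"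

definition clique_minor :: "('a,'b) pre_digraph \<Rightarrow> 'a set set \<Rightarrow> bool" where
  "clique_minor G M \<longleftrightarrow>
     (\<forall>S\<in>M. S \<noteq> {} \<and> connected_set G S) \<and> disjoint M \<and> pairwise (adjacent_sets G) M"

definition shallow_clique_minor :: "('a,'b) pre_digraph \<Rightarrow> 'a set set \<Rightarrow> bool" where
  "shallow_clique_minor G M \<longleftrightarrow> clique_minor G M \<and> (\<forall>S\<in>M. card S = 1 \<or> card S = 2)"

definition shallow_clique_minor_number :: "('a,'b) pre_digraph \<Rightarrow> nat" where
  "shallow_clique_minor_number G = (GREATEST k. \<exists>M. shallow_clique_minor G M \<and> card M = k)"

end

theory Submission
  imports Defs
begin

text \<open>
  As there is no antitriangle, every color class has the form \<open>{v, m v}\<close> for an involution \<open>m\<close>.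
  Let \<open>T\<close> be any transversal of the coloring. We find a shallow clique minor in which every
  \<open>c \<in> T\<close> lies in a member \<open>{c}\<close> or \<open>{c, m d}\<close> with \<open>d \<in> T\<close>. Relate \<open>d\<close> to \<open>c\<close> if
  \<open>d \<noteq> c\<close> is not adjacent to \<open>m c\<close>: a cycle of this relation in \<open>T\<close> would yield another coloring by
  shifting \<open>T\<close> along the cycle, so the relation is acyclic. Among the members of \<open>T\<close> with a
  non-neighbor in \<open>T\<close> choose a minimal one, \<open>a\<close>, and then a minimal \<open>b\<close> among the non-neighbors
  of \<open>a\<close> in \<open>T\<close>. The sets \<open>{a, m b}\<close> and \<open>{b, m a}\<close> are connected, adjacent to each other and
  adjacent to every vertex set meeting \<open>T - {a, b}\<close>, so one may proceed with \<open>T - {a, b}\<close>.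
\<close>

section \<open>Pairings of a finite vertex set that form its unique coloring\<close>

text \<open>Passing from \<open>U\<close> to its image repeatedly must stop, as \<open>U\<close> is
  finite. On the resulting \<open>K\<close> the map is a permutation, so \<open>K\<close> is a union
  of cycles; no single cycle has to be isolated.\<close>

lemma ex_nonempty_image_eq:
  assumes "finite U" "U \<noteq> {}" "f ` U \<subseteq> U"
  shows "\<exists>K\<subseteq>U. K \<noteq> {} \<and> f ` K = K"
  using assms
proof (induction U rule: finite_psubset_induct)
  case (psubset U)
  show ?case
  proof (cases "f ` U = U")
    case True
    then show ?thesis using psubset.prems by blast
  next
    case False
    then have "f ` U \<subset> U" using psubset.prems by blast
    moreover have "f ` U \<noteq> {}" "f ` f ` U \<subseteq> f ` U" using psubset.prems by blast+
    ultimately obtain K where "K \<subseteq> f ` U" "K \<noteq> {}" "f ` K = K"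
      using psubset.IH[of "f ` U"] by blast
    moreover have "K \<subseteq> U" using \<open>K \<subseteq> f ` U\<close> psubset.prems(2) by (rule subset_trans)
    ultimately show ?thesis by blast
  qed
qed

text \<open>
  The last assumption expresses that the classes \<open>{v, m v}\<close> form the only coloring with at most
  that many classes; there, colorings are labelled by arbitrary sets of vertices.
\<close>

locale unique_pairing =
  fixes V :: "'a set" and adj :: "'a \<Rightarrow> 'a \<Rightarrow> bool" and m :: "'a \<Rightarrow> 'a"
  assumes finite_V: "finite V"
    and adj_sym: "adj u v \<Longrightarrow> adj v u"
    and no_antitriangle: "\<lbrakk>u \<in> V; v \<in> V; w \<in> V; u \<noteq> v; u \<noteq> w; v \<noteq> w\<rbrakk> \<Longrightarrow> adj u v \<or> adj u w \<or> adj v w"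
    and mate_in [simp]: "v \<in> V \<Longrightarrow> m v \<in> V"
    and mate_mate [simp]: "v \<in> V \<Longrightarrow> m (m v) = v"
    and mate_nonadj: "v \<in> V \<Longrightarrow> \<not> adj v (m v)"
    and unique: "\<lbrakk>\<And>u v. \<lbrakk>u \<in> V; v \<in> V; u \<noteq> v; col u = col v\<rbrakk> \<Longrightarrow> \<not> adj u v;
       card (col ` V) \<le> card ((\<lambda>v. {v, m v}) ` V); u \<in> V; v \<in> V\<rbrakk>
      \<Longrightarrow> (col u :: 'a set) = col v \<longleftrightarrow> {u, m u} = {v, m v}"
begin

abbreviation "pair v \<equiv> {v, m v}"

lemma pair_eq_iff: "u \<in> V \<Longrightarrow> v \<in> V \<Longrightarrow> pair u = pair v \<longleftrightarrow> u = v \<or> u = m v"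
  by (auto simp: doubleton_eq_iff)

text \<open>Reusing the old pairs as color labels makes the bound on the number of colors
  automatic.\<close>

lemma pair_unique:
  assumes "\<And>u v. \<lbrakk>u \<in> V; v \<in> V; u \<noteq> v; col u = col v\<rbrakk> \<Longrightarrow> \<not> adj u v"
    and "col ` V \<subseteq> pair ` V" "u \<in> V" "v \<in> V"
  shows "col u = col v \<longleftrightarrow> pair u = pair v"
  using unique[OF assms(1) card_mono[OF _ assms(2)]] assms finite_V by blast

text \<open>A non-neighbor \<open>v\<close> of a one-vertex class \<open>{w}\<close> could move into
  that class. This needs no new color and unites \<open>v\<close> with \<open>w\<close>, against
  uniqueness.\<close>

lemma singleton_universal:
  assumes w: "w \<in> V" "m w = w" and v: "v \<in> V" "v \<noteq> w"
  shows "adj v w"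
proof (rule ccontr)
  assume nadj: "\<not> adj v w"
  define col where "col = pair(v := pair w)"
  have "col v = col w \<longleftrightarrow> pair v = pair w"
  proof (rule pair_unique)
    fix x y assume xy: "x \<in> V" "y \<in> V" "x \<noteq> y" "col x = col y"
    show "\<not> adj x y"
      using xy w v nadj adj_sym mate_nonadj
      by (fastforce simp: col_def pair_eq_iff doubleton_eq_iff split: if_splits)
  next
    show "col ` V \<subseteq> pair ` V" using w by (auto simp: col_def)
  qed (use w v in auto)
  then show False using v w by (simp add: col_def pair_eq_iff)
qed

text \<open>Without such an \<open>a\<close>, every member of \<open>U\<close> has a successor in
  \<open>U\<close> not adjacent to its mate. Shifting along the cycles of successors gives a second
  coloring.\<close>

lemma ex_minimal:
  assumes U: "U \<subseteq> V" "U \<noteq> {}" "inj_on pair U"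
  obtains a where "a \<in> U" "\<And>d. d \<in> U \<Longrightarrow> d \<noteq> a \<Longrightarrow> adj d (m a)"
proof (rule ccontr)
  assume "\<not> thesis"
  then have "\<forall>a\<in>U. \<exists>d\<in>U. d \<noteq> a \<and> \<not> adj d (m a)" using that by blast
  then obtain f where f: "\<And>a. a \<in> U \<Longrightarrow> f a \<in> U \<and> f a \<noteq> a \<and> \<not> adj (f a) (m a)"
    by metis
  have "finite U" using U finite_V finite_subset by blast
  moreover have "f ` U \<subseteq> U" using f by blast
  ultimately obtain K where K: "K \<subseteq> U" "K \<noteq> {}" "f ` K = K"
    using U(2) ex_nonempty_image_eq by metis
  have KV: "K \<subseteq> V" and injK: "inj_on pair K" using K U inj_on_subset by blast+
  have "finite K" using KV finite_V finite_subset by blast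
  then have "inj_on f K" using K(3) by (simp add: eq_card_imp_inj_on)
  define g where "g = inv_into K f"
  have gK: "g x \<in> K" "f (g x) = x" if "x \<in> K" for x
    using that K(3) by (auto simp: g_def inv_into_into f_inv_into_f)
  have gf: "g (f x) = x" if "x \<in> K" for x
    using that \<open>inj_on f K\<close> by (simp add: g_def)
  \<comment> \<open>Each \<open>x\<close> in \<open>K\<close> takes the color of its predecessor
    \<open>g x\<close>, all other vertices keep theirs. So \<open>f a\<close> replaces
    \<open>a\<close> beside \<open>m a\<close>, which is allowed by the choice of
    \<open>f\<close>.\<close>
  define col where "col v = pair (if v \<in> K then g v else v)" for v
  have mixed: "\<not> adj x y" if "x \<in> K" "y \<in> V" "y \<notin> K" "col x = col y" for x y
  proof -
    have "y = m (g x)"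
      using that gK KV by (auto simp: col_def doubleton_eq_iff)
    then show ?thesis using f[of "g x"] gK that K by auto
  qed
  have col: "col u = col v \<longleftrightarrow> pair u = pair v" if "u \<in> V" "v \<in> V" for u v
  proof (rule pair_unique)
    fix x y assume xy: "x \<in> V" "y \<in> V" "x \<noteq> y" "col x = col y"
    consider "x \<in> K" "y \<in> K" | "x \<in> K" "y \<notin> K" | "x \<notin> K" "y \<in> K" | "x \<notin> K" "y \<notin> K" by blast
    then show "\<not> adj x y"
    proof cases
      case 1
      then have "g x = g y" using xy gK injK by (auto simp: col_def dest: inj_onD)
      then show ?thesis using 1 gK xy by metis
    next
      case 4
      then have "x = m y" using xy by (auto simp: col_def doubleton_eq_iff)
      then show ?thesis using mate_nonadj adj_sym xy by blast
    qed (use mixed adj_sym xy in metis)+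
  next
    show "col ` V \<subseteq> pair ` V" using gK(1) KV unfolding col_def by (intro image_subsetI imageI) auto
  qed (use that in auto)
  obtain t where t: "t \<in> K" using K by blast
  have ft: "f t \<in> K" "f t \<in> V" "t \<in> V" "f t \<noteq> t" "\<not> adj (f t) (m t)"
    using t K KV f by auto
  \<comment> \<open>If \<open>t\<close> were a class by itself, it would be adjacent to
    \<open>f t\<close>. Hence \<open>m t\<close> is a second vertex of the pair, lies outside
    \<open>K\<close> and keeps its color, which \<open>f t\<close> now shares.\<close>
  then have "m t \<noteq> t" using singleton_universal[of t "f t"] by auto
  then have "m t \<notin> K"
    using inj_onD[OF injK, of "m t" t] t ft by (auto simp: insert_commute)
  then have "col (f t) = col (m t)"
    using ft t gf by (simp add: col_def insert_commute)
  then have "pair (f t) = pair t"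
    using col[of "f t" "m t"] ft by (simp add: insert_commute)
  then show False using injK ft t by (auto dest: inj_onD)
qed

lemma nonadj_mates:
  assumes ab: "a \<in> V" "b \<in> V" "pair a \<noteq> pair b" "\<not> adj a b"
  shows "m a \<noteq> a" "adj a (m b)" "adj (m a) (m b)"
proof -
  have ne: "a \<noteq> b" "a \<noteq> m b" using ab by (auto simp: pair_eq_iff)
  then show "m a \<noteq> a" using singleton_universal[of a b] ab adj_sym by blast
  have "m b \<noteq> b" using singleton_universal[of b a] ab ne by blast
  then show "adj a (m b)"
    using no_antitriangle[of a b "m b"] ab ne mate_nonadj by auto
  \<comment> \<open>Minimality of \<open>m a\<close> in this two-element set would mean that
    \<open>b\<close> is adjacent to \<open>a\<close>. So \<open>b\<close> is the minimal one, which
    is the desired adjacency of the mates.\<close>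
  have "inj_on pair {m a, b}" using ab by (auto simp: insert_commute)
  then obtain x where "x \<in> {m a, b}" "\<And>d. d \<in> {m a, b} \<Longrightarrow> d \<noteq> x \<Longrightarrow> adj d (m x)"
    using ex_minimal[of "{m a, b}"] ab by auto
  moreover have "m a \<noteq> b" using ab ne by auto
  ultimately show "adj (m a) (m b)" using ab adj_sym by force
qed

text \<open>The induction shrinks \<open>R\<close> and keeps \<open>T\<close> fixed. Partners
  outside \<open>T\<close> cannot meet roots, and partners taken from mates of \<open>R\<close>
  leave \<open>m a\<close> and \<open>m b\<close> free once \<open>a\<close> and \<open>b\<close>
  are removed.\<close>

lemma ex_rooted_sets:
  assumes T: "T \<subseteq> V" "inj_on pair T" and R: "R \<subseteq> T"
  shows "\<exists>g. inj_on g R \<and> (\<forall>c\<in>R. g c = c \<or> g c \<in> m ` R - T \<and> adj c (g c)) \<and>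
    (\<forall>c\<in>R. \<forall>d\<in>R. c \<noteq> d \<longrightarrow> (\<exists>u\<in>{c, g c}. \<exists>v\<in>{d, g d}. adj u v))"
proof -
  have "finite R" using R T finite_V finite_subset by metis
  then show ?thesis using R
  proof (induction R rule: finite_psubset_induct)
    case (psubset R)
    define U where "U = {a \<in> R. \<exists>b\<in>R. b \<noteq> a \<and> \<not> adj a b}"
    show ?case
    proof (cases "U = {}")
      case True
      \<comment> \<open>Here \<open>R\<close> is a clique, so the singletons suffice.\<close>
      then show ?thesis by (intro exI[of _ id]) (auto simp: U_def)
    next
      case False
      have RV: "R \<subseteq> V" and injR: "inj_on pair R"
        using psubset.prems T inj_on_subset by blast+
      have neq: "pair c \<noteq> pair d" if "c \<in> T" "d \<in> T" "c \<noteq> d" for c d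
        using that T by (auto dest: inj_onD)
      have sub: "X \<subseteq> V" "inj_on pair X" if "X \<subseteq> R" for X
        using that RV injR inj_on_subset by blast+
      have "U \<subseteq> R" by (auto simp: U_def)
      then obtain a where a: "a \<in> U" "\<And>d. d \<in> U \<Longrightarrow> d \<noteq> a \<Longrightarrow> adj d (m a)"
        using ex_minimal[OF sub(1) False sub(2)] by metis
      define N where "N = {b \<in> R. b \<noteq> a \<and> \<not> adj a b}"
      have "N \<subseteq> R" "N \<noteq> {}" using a by (auto simp: N_def U_def)
      then obtain b where b: "b \<in> N" "\<And>d. d \<in> N \<Longrightarrow> d \<noteq> b \<Longrightarrow> adj d (m b)"
        using ex_minimal[OF sub(1) _ sub(2)] by metis
      have abR: "a \<in> R" "b \<in> R" "a \<noteq> b" "\<not> adj a b" "\<not> adj b a"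
        using a b adj_sym by (auto simp: N_def U_def)
      have abV: "a \<in> V" "b \<in> V" "a \<in> T" "b \<in> T" using abR RV psubset.prems by auto
      have ab': "m a \<noteq> a" "m b \<noteq> b" "adj a (m b)" "adj b (m a)" "adj (m a) (m b)"
        using nonadj_mates[of a b] nonadj_mates[of b a] abV abR neq[of a b] neq[of b a] by auto
      have mT: "m c \<notin> T" if "c \<in> T" "m c \<noteq> c" for c
      proof
        assume "m c \<in> T"
        moreover have "pair (m c) = pair c" using that T by auto
        ultimately show False using neq that by blast
      qed
      define R' where "R' = R - {a, b}"
      have "R' \<subset> R" "R' \<subseteq> T" using abR psubset.prems by (auto simp: R'_def)
      then obtain g where g: "inj_on g R'"
        "\<And>c. c \<in> R' \<Longrightarrow> g c = c \<or> g c \<in> m ` R' - T \<and> adj c (g c)"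
        "\<And>c d. c \<in> R' \<Longrightarrow> d \<in> R' \<Longrightarrow> c \<noteq> d \<Longrightarrow> \<exists>u\<in>{c, g c}. \<exists>v\<in>{d, g d}. adj u v"
        using psubset.IH[of R'] by metis
      define h where "h = g(a := m b, b := m a)"
      have h_simps [simp]: "h a = m b" "h b = m a" using abR by (auto simp: h_def)
      have hR' [simp]: "h c = g c" if "c \<in> R'" for c using that by (auto simp: h_def R'_def)
      have R_eq: "R = insert a (insert b R')" using abR by (auto simp: R'_def)
      have m_inj: "m c \<noteq> m d" if "c \<in> V" "d \<in> V" "c \<noteq> d" for c d
        using that mate_mate by metis
      have notin: "m a \<notin> g ` R'" "m b \<notin> g ` R'"
      proof -
        have "m c \<noteq> g d" if "c \<in> {a, b}" "d \<in> R'" for c d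
        proof -
          have "m c \<notin> T" using that ab' abV mT by auto
          moreover have "m c \<notin> m ` R'"
            using that m_inj abV RV by (auto simp: R'_def image_iff)
          ultimately show ?thesis using g(2)[OF that(2)] that \<open>R' \<subseteq> T\<close> by auto
        qed
        then show "m a \<notin> g ` R'" "m b \<notin> g ` R'" by auto
      qed
      have "h ` R' = g ` R'" "inj_on h R'"
        using g(1) by (auto simp: inj_on_def)
      then have "inj_on h R"
        using notin m_inj[of a b] abV abR by (simp add: R_eq) auto
      moreover have "h c = c \<or> h c \<in> m ` R - T \<and> adj c (h c)" if "c \<in> R" for c
        using that g(2)[of c] ab' abV mT by (auto simp: R_eq)
      moreover have "\<exists>u\<in>{c, h c}. \<exists>v\<in>{d, h d}. adj u v"
        if "c \<in> R" "d \<in> R" "c \<noteq> d" for c d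
      proof -
        \<comment> \<open>A \<open>y\<close> not adjacent to \<open>a\<close> lies in
          \<open>N\<close>, so minimality of \<open>b\<close> joins it to \<open>m b\<close>. A
          \<open>y\<close> not adjacent to \<open>b\<close> lies in \<open>U\<close>, so minimality
          of \<open>a\<close> joins it to \<open>m a\<close>.\<close>
        have new: "\<exists>u\<in>{x, h x}. adj u y" if x: "x \<in> {a, b}" and y: "y \<in> R'" for x y
        proof (cases "x = a")
          case True
          show ?thesis
          proof (cases "adj a y")
            case False
            then have "y \<in> N" "y \<noteq> b" using y by (auto simp: N_def R'_def)
            then show ?thesis using b(2) adj_sym True by auto
          qed (use True in auto)
        next
          case False
          then have [simp]: "x = b" using x by simp
          show ?thesis
          proof (cases "adj b y")
            case nb: False
            then have "\<not> adj y b" using adj_sym by blast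
            then have "y \<in> U" "y \<noteq> a" using y abR by (auto simp: U_def R'_def)
            then show ?thesis using a(2) adj_sym by auto
          qed auto
        qed
        consider "c \<in> R'" "d \<in> R'" | "c \<in> R'" "d \<in> {a, b}" | "c \<in> {a, b}" "d \<in> R'"
          | "c \<in> {a, b}" "d \<in> {a, b}"
          using \<open>c \<in> R\<close> \<open>d \<in> R\<close> unfolding R_eq by blast
        then show ?thesis
        proof cases
          case 1
          then show ?thesis using g(3) that by simp
        next
          case 2
          then show ?thesis using new[of d c] adj_sym by blast
        next
          case 3
          then show ?thesis using new[of c d] by blast
        next
          \<comment> \<open>The two new sets are adjacent through the edge between
            \<open>m a\<close> and \<open>m b\<close>.\<close>
          case 4
          then show ?thesis using that ab'(5) adj_sym by auto
        qed
      qed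
      ultimately show ?thesis by blast
    qed
  qed
qed

end

section \<open>From graphs and their colorings to pairings\<close>

lemma connected_set_singleton:
  assumes "v \<in> verts G"
  shows "connected_set G {v}"
  using assms
  by (auto simp: connected_set_def connected_def strongly_connected_def reachable_def)

lemma connected_set_edge:
  assumes "graph G" and uv: "u \<rightarrow>\<^bsub>G\<^esub> v"
  shows "connected_set G {u, v}"
proof -
  interpret graph G by fact
  have V: "u \<in> verts G" "v \<in> verts G" using uv by auto
  interpret W: wf_digraph "G \<restriction> {u, v}" using V by auto
  have vu: "v \<rightarrow>\<^bsub>G\<^esub> u" using uv graph_symmetric by blast
  have "u \<rightarrow>\<^bsub>G \<restriction> {u, v}\<^esub> v" "v \<rightarrow>\<^bsub>G \<restriction> {u, v}\<^esub> u"
    using uv vu by (auto simp: arcs_ends_conv)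
  then have "x \<rightarrow>\<^sup>*\<^bsub>G \<restriction> {u, v}\<^esub> y" if "x \<in> {u, v}" "y \<in> {u, v}" for x y
    using that by (auto intro: W.reachable_adjI)
  then show ?thesis
    using V W.reachable_mk_symmetricI
    by (auto simp: connected_set_def connected_def strongly_connected_def)
qed

lemma shallow_clique_minor_number_ge:
  assumes "finite (verts G)" "shallow_clique_minor G M"
  shows "card M \<le> shallow_clique_minor_number G"
  unfolding shallow_clique_minor_number_def
proof (rule Greatest_le_nat)
  fix k assume "\<exists>M. shallow_clique_minor G M \<and> card M = k"
  \<comment> \<open>A minor is a set of vertex sets, which supplies the upper bound that
    \<open>GREATEST\<close> requires.\<close>
  then show "k \<le> card (Pow (verts G))"
    using assms(1) by (auto simp: shallow_clique_minor_def clique_minor_def connected_set_def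
        simp del: card_Pow intro!: card_mono)
qed (use assms in blast)

lemma chromatic_number_le: "coloring G P \<Longrightarrow> chromatic_number G \<le> card P"
  unfolding chromatic_number_def by (rule Least_le) blast

lemma anticlique_card_le_2:
  assumes "finite (verts G)" "\<nexists>S. antitriangle G S" "anticlique G S"
  shows "card S \<le> 2"
proof (rule ccontr)
  assume "\<not> card S \<le> 2"
  then obtain X where "X \<subseteq> S" "card X = 3"
    using obtain_subset_with_card_n[of 3 S] by auto
  then show False
    using assms by (auto simp: antitriangle_def anticlique_def dest: pairwise_subset)
qed

lemma coloring_fibres:
  assumes "\<And>u v. \<lbrakk>u \<in> verts G; v \<in> verts G; u \<noteq> v; col u = col v\<rbrakk> \<Longrightarrow> \<not> u \<rightarrow>\<^bsub>G\<^esub> v"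
  shows "coloring G ((\<lambda>u. {v \<in> verts G. col v = col u}) ` verts G)"
  using assms
  by (auto simp: coloring_def partition_on_def disjoint_def disjnt_def anticlique_def pairwise_def)

text \<open>Classes have one or two members, so \<open>m\<close> sends a vertex to the other member
  of its class, or to itself in a singleton class. Uniqueness passes to labelled colorings through
  their fibres.\<close>

lemma unique_coloring_pairing:
  fixes G :: "('a,'b) pre_digraph"
  assumes "graph G" and at: "\<nexists>S. antitriangle G S"
    and P: "coloring G P" "card P = chromatic_number G"
    and uniq: "\<And>Q. coloring G Q \<Longrightarrow> card Q = chromatic_number G \<Longrightarrow> Q = P"
  obtains m where "unique_pairing (verts G) (\<lambda>u v. u \<rightarrow>\<^bsub>G\<^esub> v) m" "P = (\<lambda>v. {v, m v}) ` verts G"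
proof -
  interpret graph G by fact
  let ?V = "verts G"
  have part: "partition_on ?V P" and anti: "\<And>S. S \<in> P \<Longrightarrow> anticlique G S"
    using P by (auto simp: coloring_def)
  have same: "S = S'" if "S \<in> P" "S' \<in> P" "v \<in> S" "v \<in> S'" for S S' v
    using that part by (auto simp: partition_on_def disjoint_def)
  have "\<exists>w. {v, w} \<in> P" if v: "v \<in> ?V" for v
  proof -
    obtain S where S: "S \<in> P" "v \<in> S" using v part by (auto simp: partition_on_def)
    then have "S \<subseteq> ?V" using anti by (auto simp: anticlique_def)
    then have "finite S" using finite_verts finite_subset by blast
    moreover have "card S \<le> 2" using anticlique_card_le_2[OF finite_verts at anti[OF S(1)]] .
    ultimately have "card S = 1 \<or> card S = 2"
      using S by (metis One_nat_def card_0_eq empty_iff le_Suc_eq le_zero_eq numeral_2_eq_2)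
    then obtain w where "S = {v, w}"
      using S by (auto simp: card_1_singleton_iff card_2_iff)
    then show ?thesis using S by auto
  qed
  then obtain m where m: "\<And>v. v \<in> ?V \<Longrightarrow> {v, m v} \<in> P" by metis
  have P_eq: "P = (\<lambda>v. {v, m v}) ` ?V"
  proof
    show "P \<subseteq> (\<lambda>v. {v, m v}) ` ?V"
    proof
      fix S assume S: "S \<in> P"
      then obtain v where "v \<in> S" using part by (metis ex_in_conv partition_on_def)
      moreover have "v \<in> ?V" using S \<open>v \<in> S\<close> part by (auto simp: partition_on_def)
      ultimately show "S \<in> (\<lambda>v. {v, m v}) ` ?V" using same[OF S m, of v v] by blast
    qed
  qed (use m in blast)
  have mV: "m v \<in> ?V" if "v \<in> ?V" for v
    using m[OF that] part by (auto simp: partition_on_def)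
  have mm: "m (m v) = v" if "v \<in> ?V" for v
  proof -
    have "{v, m v} = {m v, m (m v)}" using same[OF m[OF that] m[OF mV[OF that]]] by blast
    then show ?thesis by (auto simp: doubleton_eq_iff)
  qed
  have "unique_pairing ?V (\<lambda>u v. u \<rightarrow>\<^bsub>G\<^esub> v) m"
  proof
    fix u v w assume "u \<in> ?V" "v \<in> ?V" "w \<in> ?V" "u \<noteq> v" "u \<noteq> w" "v \<noteq> w"
    then show "u \<rightarrow>\<^bsub>G\<^esub> v \<or> u \<rightarrow>\<^bsub>G\<^esub> w \<or> v \<rightarrow>\<^bsub>G\<^esub> w"
      using at[unfolded not_ex, rule_format, of "{u, v, w}"] graph_symmetric
      by (auto simp: antitriangle_def anticlique_def pairwise_def)
  next
    fix v assume v: "v \<in> ?V"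
    then show "\<not> v \<rightarrow>\<^bsub>G\<^esub> m v"
      using anti[OF m[OF v]] adj_not_same[of v] by (auto simp: anticlique_def pairwise_def)
  next
    fix col :: "'a \<Rightarrow> 'a set" and u v
    assume col: "\<And>u v. \<lbrakk>u \<in> ?V; v \<in> ?V; u \<noteq> v; col u = col v\<rbrakk> \<Longrightarrow> \<not> u \<rightarrow>\<^bsub>G\<^esub> v"
      and card: "card (col ` ?V) \<le> card ((\<lambda>v. {v, m v}) ` ?V)" and uv: "u \<in> ?V" "v \<in> ?V"
    let ?fib = "\<lambda>u. {v \<in> ?V. col v = col u}"
    have "?fib ` ?V = (\<lambda>i. {v \<in> ?V. col v = i}) ` col ` ?V" by auto
    then have "card (?fib ` ?V) \<le> card (col ` ?V)" by (simp add: card_image_le)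
    \<comment> \<open>There are at most as many fibres as classes of \<open>P\<close>, and no
      coloring has fewer classes than \<open>P\<close>. Equality makes the uniqueness of
      \<open>P\<close> applicable.\<close>
    then have "card (?fib ` ?V) = chromatic_number G"
      using card P P_eq chromatic_number_le[OF coloring_fibres[of G col]] col by force
    then have fib: "?fib ` ?V = P" using uniq coloring_fibres[of G col] col by blast
    have "?fib x = {x, m x}" if "x \<in> ?V" for x
    proof (rule same)
      show "?fib x \<in> P" using fib that by blast
    qed (use m that in auto)
    then show "col u = col v \<longleftrightarrow> {u, m u} = {v, m v}"
      using uv by blast
  qed (use mV mm graph_symmetric in auto)
  then show thesis using P_eq that by blast
qed

section \<open>The clique minor grown from a transversal\<close>

theorem theorem3:
  fixes G :: "('a,'b) pre_digraph"
  assumes "graph G"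
    and "\<nexists>S. antitriangle G S"
    and "\<exists>!P. coloring G P \<and> card P = chromatic_number G"
  shows "shallow_clique_minor_number G \<ge> chromatic_number G \<and>
    real (shallow_clique_minor_number G) \<ge> real (card (verts G)) / 2"
proof -
  interpret graph G by fact
  let ?V = "verts G"
  obtain P where P: "coloring G P" "card P = chromatic_number G"
    and uniq: "\<And>Q. coloring G Q \<Longrightarrow> card Q = chromatic_number G \<Longrightarrow> Q = P"
    using assms(3) by blast
  obtain m where m: "unique_pairing ?V (\<lambda>u v. u \<rightarrow>\<^bsub>G\<^esub> v) m"
    and P_eq: "P = (\<lambda>v. {v, m v}) ` ?V"
    using unique_coloring_pairing[OF assms(1,2) P uniq] by blast
  interpret unique_pairing ?V "\<lambda>u v. u \<rightarrow>\<^bsub>G\<^esub> v" m by fact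
  \<comment> \<open>\<open>T\<close> picks one vertex from each color class, so it has as many
    elements as \<open>P\<close>.\<close>
  obtain T where T: "T \<subseteq> ?V" "inj_on pair T" "pair ` T = P"
    using subset_image_inj[of P pair ?V] P_eq by auto
  obtain g where g: "inj_on g T" "\<And>c. c \<in> T \<Longrightarrow> g c = c \<or> g c \<in> m ` T - T \<and> c \<rightarrow>\<^bsub>G\<^esub> g c"
    "\<And>c d. c \<in> T \<Longrightarrow> d \<in> T \<Longrightarrow> c \<noteq> d \<Longrightarrow> \<exists>u\<in>{c, g c}. \<exists>v\<in>{d, g d}. u \<rightarrow>\<^bsub>G\<^esub> v"
    using ex_rooted_sets[OF T(1,2) order_refl] by blast
  define M where "M = (\<lambda>c. {c, g c}) ` T"
  \<comment> \<open>\<open>g d\<close> is either \<open>d\<close> or outside \<open>T\<close>, so it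
    never equals another root; two partners differ by injectivity of \<open>g\<close>.\<close>
  have disj: "{c, g c} \<inter> {d, g d} = {}" if "c \<in> T" "d \<in> T" "c \<noteq> d" for c d
    using that g(2)[of c] g(2)[of d] inj_onD[OF g(1), of c d] by auto
  have "inj_on (\<lambda>c. {c, g c}) T"
    using disj by (intro inj_onI) blast
  then have "card M = card T" by (simp add: M_def card_image)
  also have "card T = card P" using T card_image by metis
  finally have card_M: "card M = card P" .
  have "shallow_clique_minor G M"
    unfolding shallow_clique_minor_def clique_minor_def
  proof (intro conjI ballI)
    fix S assume "S \<in> M"
    then obtain c where c: "c \<in> T" "S = {c, g c}" by (auto simp: M_def)
    then show "S \<noteq> {}" by simp
    show "connected_set G S"
      using g(2)[OF c(1)] c T connected_set_singleton[of c G] connected_set_edge[OF assms(1), of c "g c"]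
      by auto
    show "card S = 1 \<or> card S = 2" using c by (cases "g c = c") auto
  next
    show "disjoint M" using disj by (fastforce simp: M_def disjoint_def)
    show "pairwise (adjacent_sets G) M"
    proof (rule pairwiseI)
      fix S S' assume "S \<in> M" "S' \<in> M" "S \<noteq> S'"
      then show "adjacent_sets G S S'" using g(3) unfolding M_def adjacent_sets_def by blast
    qed
  qed
  then have ge: "chromatic_number G \<le> shallow_clique_minor_number G"
    using shallow_clique_minor_number_ge[OF finite_verts] card_M P by metis
  have "finite T" using T finite_verts finite_subset by blast
  \<comment> \<open>Every vertex is in \<open>T\<close> or the mate of a member of \<open>T\<close>,
    so there are at most twice as many vertices as colors.\<close>
  have "?V \<subseteq> T \<union> m ` T"
  proof
    fix v assume v: "v \<in> ?V"
    then obtain t where "t \<in> T" "pair v = pair t" using T P_eq by blast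
    then show "v \<in> T \<union> m ` T" by (auto simp: doubleton_eq_iff)
  qed
  then have "card ?V \<le> card (T \<union> m ` T)" using \<open>finite T\<close> by (intro card_mono) auto
  also have "\<dots> \<le> card T + card T"
    using card_Un_le[of T "m ` T"] card_image_le[OF \<open>finite T\<close>, of m] by linarith
  finally show ?thesis using ge \<open>card T = card P\<close> P by simp
qed

end
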